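(* Let $k\ge 3$ and let $\mathbb{X}$ be three points in generic position in $\mathbb{P}^1\times\cdots\times\mathbb{P}^1$ ($k$ times). Then $$\nu(I_{\mathbb{X}})\ge v(3;1,\ldots,1)+\binom{k}{3},$$ where $1$ is repeated $k$ times in $v(3;1,\ldots,1)$.
   Context: $\mathbf{k}$ is an algebraically closed field of characteristic $0$; $\mathbb{N}=\{0,1,2,\ldots\}$; $[k]=\{1,\ldots,k\}$; $e_1,\ldots,e_k$ is the standard basis of $\mathbb{N}^k$; $\mathbb{N}^k$ is partially ordered coordinatewise, and $\min\mathcal{S}$ denotes the set of minimal elements of $\mathcal{S}\subseteq\mathbb{N}^k$. $R=\mathbf{k}[x_{l,m}: 1\le l\le k,\ 0\le m\le 1]$ is $\mathbb{N}^k$-graded by $\deg x_{l,m}=e_l$; it is the coordinate ring of $\mathbb{P}^1\times\cdots\times\mathbb{P}^1$ ($k$ times) over $\mathbf{k}$. $N(\underline{i})=\dim_{\mathbf{k}}R_{\underline{i}}=\prod_{l=1}^k(i_l+1)$. For a nonempty finite set $\mathbb{X}$ of points, $I_{\mathbb{X}}\subseteq R$ is the ideal generated by the $\mathbb{N}^k$-homogeneous forms vanishing at every point of $\mathbb{X}$, and $\nu(I_{\mathbb{X}})$ is the minimal number of generators of $I_{\mathbb{X}}$. A set $\mathbb{X}$ of $s$ distinct points is in generic position if $\dim_{\mathbf{k}}(R/I_{\mathbb{X}})_{\underline{i}}=\min\{N(\underline{i}),s\}$ for all $\underline{i}\in\mathbb{N}^k$. Definition of $v(3;1,\ldots,1)$: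 let $s=3$, $\mathcal{D}=\min\{\underline{i}\in\mathbb{N}^k\mid N(\underline{i})>s\}$ and $\mathcal{D}+e_l=\{\underline{i}+e_l\mid\underline{i}\in\mathcal{D}\}$; for $\underline{i}\in\mathcal{D}$ let $\mathbb{D}_{\underline{i}}=\{\underline{j}\in\mathbb{N}^k\mid\underline{j}\ge\underline{i}\}\setminus\{\underline{i},\underline{i}+e_1,\ldots,\underline{i}+e_k\}$; let $\mathbb{D}=\left[\bigcup_{l=1}^k(\mathcal{D}+e_l)\right]\setminus\bigcup_{\underline{i}\in\mathcal{D}}\mathbb{D}_{\underline{i}}$; for $\underline{j}\in\mathbb{D}$ let $L_{\underline{j}}=\{l\in[k]\mid\underline{j}\in\mathcal{D}+e_l\}$. Then $$v(3;1,\ldots,1)=\sum_{\underline{i}\in\mathcal{D}}(N(\underline{i})-s)+\sum_{\underline{j}\in\mathbb{D}}\max\Big\{0,\ N(\underline{j})-s-\sum_{l\in L_{\underline{j}}}2\big(N(\underline{j}-e_l)-s\big)\Big\}.$$ *)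

theory Defs
  imports
    "HOL-Analysis.Finite_Cartesian_Product"
    "HOL-Computational_Algebra.Polynomial"
    "HOL-Library.Poly_Mapping"
    "HOL-Library.Function_Algebras"
    "HOL-Library.Numeral_Type"
    "HOL-Library.Extended_Nat"
begin

text \<open>
  The index set \<open>[k]\<close> is a finite type \<open>'k\<close> with \<open>CARD('k) = k\<close>, and \<open>\<nat>\<^sup>k\<close> is
  \<open>'k \<Rightarrow> nat\<close> with its pointwise order and pointwise addition and subtraction.
\<close>

definition e_vec :: "'k \<Rightarrow> 'k \<Rightarrow> nat" where
  "e_vec l = (\<lambda>l'. if l' = l then 1 else 0)"


section \<open>The projective line and its powers\<close>

definition proj_rel :: "'a::field ^ 2 \<Rightarrow> 'a ^ 2 \<Rightarrow> bool" where
  "proj_rel u v \<longleftrightarrow> u \<noteq> 0 \<and> v \<noteq> 0 \<and> (\<exists>c. c \<noteq> 0 \<and> v = c *s u)"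

lemma part_equivp_proj_rel: "part_equivp (proj_rel :: 'a::field ^ 2 \<Rightarrow> 'a ^ 2 \<Rightarrow> bool)"
proof (rule part_equivpI)
  have "(1 :: 'a ^ 2) \<noteq> 0" by (simp add: vec_eq_iff)
  moreover have "(1 :: 'a ^ 2) = 1 *s 1" by simp
  ultimately show "\<exists>x :: 'a ^ 2. proj_rel x x"
    unfolding proj_rel_def by (metis zero_neq_one)
  show "symp (proj_rel :: 'a ^ 2 \<Rightarrow> _)"
  proof (rule sympI)
    fix u v :: "'a ^ 2" assume "proj_rel u v"
    then obtain c where c: "u \<noteq> 0" "v \<noteq> 0" "c \<noteq> 0" "v = c *s u"
      by (auto simp: proj_rel_def)
    then have "inverse c \<noteq> 0 \<and> u = inverse c *s v"
      by (simp add: vector_smult_assoc)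
    with c show "proj_rel v u" unfolding proj_rel_def by blast
  qed
  show "transp (proj_rel :: 'a ^ 2 \<Rightarrow> _)"
  proof (rule transpI)
    fix u v w :: "'a ^ 2" assume "proj_rel u v" "proj_rel v w"
    then obtain c d where "u \<noteq> 0" "w \<noteq> 0" "c \<noteq> 0" "d \<noteq> 0" "w = (d * c) *s u"
      by (auto simp: proj_rel_def vector_smult_assoc)
    then show "proj_rel u w" unfolding proj_rel_def by (metis no_zero_divisors)
  qed
qed

quotient_type (overloaded) 'a proj_line = "'a::field ^ 2" / partial: proj_rel
  by (rule part_equivp_proj_rel)

text \<open>
  A point of \<open>\<P>\<^sup>1 \<times> \<dots> \<times> \<P>\<^sup>1\<close> is a function \<open>'k \<Rightarrow> 'a proj_line\<close>;
  \<open>homog_coords P u\<close> says that \<open>u l\<close> is a vector of homogeneous coordinates of the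
  \<open>l\<close>-th component of \<open>P\<close>, for every \<open>l\<close>.
\<close>

definition homog_coords :: "('k \<Rightarrow> 'a::field proj_line) \<Rightarrow> ('k \<Rightarrow> 'a ^ 2) \<Rightarrow> bool" where
  "homog_coords P u \<longleftrightarrow> (\<forall>l. u l \<noteq> 0 \<and> abs_proj_line (u l) = P l)"


section \<open>The multigraded polynomial ring\<close>

text \<open>
  A monomial is an exponent function with finite support on the variables; the index
  \<open>(l, m)\<close> stands for \<open>x\<^bsub>l,m\<^esub>\<close>, where \<open>m\<close> ranges over the two-element type \<open>2\<close>,
  whose elements are \<open>0\<close> and \<open>1\<close>. The convolution product of finitely supported
  functions makes the type \<open>('k, 'a) mpoly\<close> the polynomial ring \<open>R\<close>.
\<close>

type_synonym 'k mon = "('k \<times> 2) \<Rightarrow>\<^sub>0 nat"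
type_synonym ('k, 'a) mpoly = "'k mon \<Rightarrow>\<^sub>0 'a"

definition mdeg :: "'k mon \<Rightarrow> 'k \<Rightarrow> nat" where
  "mdeg t = (\<lambda>l. \<Sum>m\<in>UNIV. Poly_Mapping.lookup t (l, m))"

definition homog :: "('k \<Rightarrow> nat) \<Rightarrow> ('k, 'a::zero) mpoly set" where
  "homog i = {f. \<forall>t\<in>Poly_Mapping.keys f. mdeg t = i}"

definition eval_mpoly :: "('k, 'a::comm_ring_1) mpoly \<Rightarrow> ('k \<Rightarrow> 'a ^ 2) \<Rightarrow> 'a" where
  "eval_mpoly f u = (\<Sum>t\<in>Poly_Mapping.keys f. Poly_Mapping.lookup f t *
     (\<Prod>(l, m)\<in>Poly_Mapping.keys t. (u l $ m) ^ Poly_Mapping.lookup t (l, m)))"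

definition scale :: "'a::comm_ring_1 \<Rightarrow> ('k, 'a) mpoly \<Rightarrow> ('k, 'a) mpoly" where
  "scale c f = Poly_Mapping.single 0 c * f"

lemma vector_space_scale: "vector_space (scale :: 'a::field \<Rightarrow> ('k, 'a) mpoly \<Rightarrow> _)"
  by unfold_locales
    (simp_all add: scale_def distrib_left distrib_right single_add mult_single mult.assoc[symmetric])

text \<open>The dimension of \<open>homog i\<close>, i.e. the number of monomials of multidegree \<open>i\<close>.\<close>

definition N_dim :: "('k::finite \<Rightarrow> nat) \<Rightarrow> nat" where
  "N_dim i = (\<Prod>l\<in>UNIV. i l + 1)"


section \<open>Ideals\<close>

text \<open>The ideal generated by \<open>S\<close>: the submodule of \<open>R\<close>, as a module over itself, spanned by \<open>S\<close>.\<close>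

lemma module_mult: "module ((*) :: ('k, 'a::comm_ring_1) mpoly \<Rightarrow> _)"
  by unfold_locales (simp_all add: algebra_simps)

definition ideal_gen :: "('k, 'a::comm_ring_1) mpoly set \<Rightarrow> ('k, 'a) mpoly set" where
  "ideal_gen S = module.span (*) S"

text \<open>
  The minimal number of generators. It is taken in \<^typ>\<open>enat\<close>, so that it would be
  \<open>\<infinity>\<close> for an ideal without a finite generating set; \<open>R\<close> being Noetherian, this does not occur.
\<close>

definition num_gens :: "('k, 'a::comm_ring_1) mpoly set \<Rightarrow> enat" where
  "num_gens I = Inf {enat (card G) | G. finite G \<and> ideal_gen G = I}"

text \<open>
  For a homogeneous form, vanishing does not depend on the choice of homogeneous coordinates.
\<close>

definition vanishes_at :: "('k, 'a::field) mpoly \<Rightarrow> ('k \<Rightarrow> 'a proj_line) \<Rightarrow> bool" where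
  "vanishes_at f P \<longleftrightarrow> (\<forall>u. homog_coords P u \<longrightarrow> eval_mpoly f u = 0)"

definition vanishing_ideal :: "('k \<Rightarrow> 'a::field proj_line) set \<Rightarrow> ('k, 'a) mpoly set" where
  "vanishing_ideal X = ideal_gen {f. (\<exists>i. f \<in> homog i) \<and> (\<forall>P\<in>X. vanishes_at f P)}"


section \<open>Generic position\<close>

text \<open>
  \<open>quotient_basis V W B\<close>: the classes modulo \<open>W\<close> of the elements of \<open>B \<subseteq> V\<close> are linearly
  independent and span the image of \<open>V\<close> modulo \<open>W\<close>, where \<open>V\<close> and \<open>W\<close> are subspaces.
  Independence forces distinct elements of \<open>B\<close> to have distinct classes, so \<open>card B\<close> is the
  dimension of that image. As with the library's \<open>dim\<close>, the dimension is \<open>0\<close> by convention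
  when it is infinite.
\<close>

definition quotient_basis ::
  "('k, 'a::field) mpoly set \<Rightarrow> ('k, 'a) mpoly set \<Rightarrow> ('k, 'a) mpoly set \<Rightarrow> bool" where
  "quotient_basis V W B \<longleftrightarrow>
     B \<subseteq> V \<and>
     (\<forall>T c. finite T \<longrightarrow> T \<subseteq> B \<longrightarrow> (\<Sum>b\<in>T. scale (c b) b) \<in> W \<longrightarrow> (\<forall>b\<in>T. c b = 0)) \<and>
     (\<forall>v\<in>V. \<exists>w\<in>module.span scale B. v - w \<in> W)"

definition quotient_dim :: "('k, 'a::field) mpoly set \<Rightarrow> ('k, 'a) mpoly set \<Rightarrow> nat" where
  "quotient_dim V W = card (SOME B. quotient_basis V W B)"

text \<open>\<open>(R/I)\<^bsub>i\<^esub>\<close> is the image of \<open>R\<^bsub>i\<^esub>\<close> in \<open>R/I\<close>.\<close>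

definition hilbert_fun :: "('k, 'a::field) mpoly set \<Rightarrow> ('k \<Rightarrow> nat) \<Rightarrow> nat" where
  "hilbert_fun I i = quotient_dim (homog i) I"

definition generic_position :: "('k::finite \<Rightarrow> 'a::field proj_line) set \<Rightarrow> bool" where
  "generic_position X \<longleftrightarrow>
     finite X \<and> X \<noteq> {} \<and> (\<forall>i. hilbert_fun (vanishing_ideal X) i = min (N_dim i) (card X))"


section \<open>The number \<open>v(s; 1, \<dots>, 1)\<close>\<close>

definition min_elems :: "('k \<Rightarrow> nat) set \<Rightarrow> ('k \<Rightarrow> nat) set" where
  "min_elems S = {i \<in> S. \<forall>j\<in>S. j \<le> i \<longrightarrow> j = i}"

definition D_set :: "nat \<Rightarrow> ('k::finite \<Rightarrow> nat) set" where
  "D_set s = min_elems {i. N_dim i > s}"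

definition D_shift :: "nat \<Rightarrow> 'k::finite \<Rightarrow> ('k \<Rightarrow> nat) set" where
  "D_shift s l = {i + e_vec l | i. i \<in> D_set s}"

definition DD_at :: "('k \<Rightarrow> nat) \<Rightarrow> ('k \<Rightarrow> nat) set" where
  "DD_at i = {j. i \<le> j} - ({i} \<union> {i + e_vec l | l. True})"

definition DD_set :: "nat \<Rightarrow> ('k::finite \<Rightarrow> nat) set" where
  "DD_set s = (\<Union>l. D_shift s l) - (\<Union>i\<in>D_set s. DD_at i)"

definition L_set :: "nat \<Rightarrow> ('k::finite \<Rightarrow> nat) \<Rightarrow> 'k set" where
  "L_set s j = {l. j \<in> D_shift s l}"

text \<open>
  \<open>v_num TYPE('k) s\<close> is \<open>v(s; 1, \<dots>, 1)\<close> with \<open>CARD('k)\<close> ones. In the inner sum the pointwise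
  subtraction \<open>j - e_vec l\<close> is never truncated, since \<open>l \<in> L_set s j\<close> means \<open>j - e_vec l \<in> D_set s\<close> and \<open>j l \<ge> 1\<close>.
\<close>

definition v_num :: "'k::finite itself \<Rightarrow> nat \<Rightarrow> int" where
  "v_num _ s =
     (\<Sum>i\<in>(D_set s :: ('k \<Rightarrow> nat) set). int (N_dim i) - int s) +
     (\<Sum>j\<in>(DD_set s :: ('k \<Rightarrow> nat) set).
        max 0 (int (N_dim j) - int s - (\<Sum>l\<in>L_set s j. 2 * (int (N_dim (j - e_vec l)) - int s))))"

text \<open>Both sums in \<open>v_num\<close> are finite, and \<open>v_num\<close> is nonnegative.\<close>

lemma finite_D_set: "finite (D_set s :: ('k::finite \<Rightarrow> nat) set)"
proof (rule finite_subset)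
  show "D_set s \<subseteq> (PiE UNIV (\<lambda>_. {..s}) :: ('k \<Rightarrow> nat) set)"
  proof
    fix i :: "'k \<Rightarrow> nat" assume i: "i \<in> D_set s"
    have "i l \<le> s" for l
    proof (rule ccontr)
      assume "\<not> i l \<le> s"
      define q :: "'k \<Rightarrow> nat" where "q = (\<lambda>l'. if l' = l then s else 0)"
      have "N_dim q = (\<Prod>l'\<in>UNIV. if l' = l then s + 1 else 1)"
        unfolding N_dim_def q_def by (rule prod.cong) auto
      then have "N_dim q = s + 1" by simp
      then have "q \<in> {i. N_dim i > s}" by simp
      moreover have "q \<le> i" using \<open>\<not> i l \<le> s\<close> by (auto simp: q_def le_fun_def)
      ultimately have "q = i" using i unfolding D_set_def min_elems_def by blast
      then have "i l = s" by (auto simp: q_def)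
      with \<open>\<not> i l \<le> s\<close> show False by simp
    qed
    then show "i \<in> PiE UNIV (\<lambda>_. {..s})" by (auto simp: PiE_def)
  qed
  show "finite (PiE UNIV (\<lambda>_. {..s}) :: ('k \<Rightarrow> nat) set)"
    by (rule finite_PiE) auto
qed

lemma finite_DD_set: "finite (DD_set s :: ('k::finite \<Rightarrow> nat) set)"
proof -
  have "finite (\<Union>l::'k. D_shift s l)"
    unfolding D_shift_def by (auto simp: setcompr_eq_image intro!: finite_imageI finite_D_set)
  then show ?thesis unfolding DD_set_def by (rule finite_Diff)
qed

lemma v_num_nonneg: "v_num TYPE('k::finite) s \<ge> 0"
  unfolding v_num_def by (intro add_nonneg_nonneg sum_nonneg) (auto simp: D_set_def min_elems_def)

end

theory Submission
  imports Defs
begin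

text \<open>
  It suffices to exhibit, for enough multidegrees \<open>j\<close>, a functional on the degree \<open>j\<close> part that
  kills \<open>\<mm> I\<close>, where \<open>\<mm>\<close> is the ideal generated by the variables, but not \<open>I\<close>. By generic position
  the \<open>l\<close>-th coordinates of the three points are distinct, so they can be normalised to \<open>u\<^sub>l\<close>, \<open>v\<^sub>l\<close>,
  \<open>u\<^sub>l + v\<^sub>l\<close>. In total degree 3 evaluation at \<open>u - v\<close> works: on the diagonal line through
  the three points a form in \<open>I\<close> of total degree at most 2 is a binary form with three zeros. In degree
  \<open>e\<^sub>a + e\<^sub>b\<close> evaluation at a point with coordinates \<open>u\<^sub>a\<close> and \<open>v\<^sub>b\<close> works. These degrees include
  those counted by \<open>v(3; 1, \<dots>, 1)\<close> and the \<open>k choose 3\<close> degrees \<open>e\<^sub>a + e\<^sub>b + e\<^sub>c\<close>, which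
  contribute \<open>max {0, 8 - 3 - 6} = 0\<close> to \<open>v(3; 1, \<dots>, 1)\<close>.
\<close>

section \<open>Preliminaries and solutions of underdetermined linear systems\<close>

lemma UNIV_two: "(UNIV :: 2 set) = {0, 1}"
  by (rule card_seteq[symmetric]) auto

lemma e_vec_apply [simp]: "e_vec l l' = (if l' = l then 1 else 0)"
  by (simp add: e_vec_def)

lemma sum_e_vec [simp]: "(\<Sum>l\<in>UNIV. e_vec a l) = (1 :: nat)" for a :: "'k::finite"
  by simp

text \<open>A homogeneous linear system with more unknowns, indexed by \<open>J\<close>, than
  equations, indexed by \<open>G\<close>, is solved by Gaussian elimination. The unknowns will be
  coefficients first of a basis and later of separating forms.\<close>

lemma nontrivial_relation:
  fixes a :: "'j \<Rightarrow> 'g \<Rightarrow> 'a::field"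
  assumes "finite G" "finite J" "card G < card J"
  obtains c j where "j \<in> J" "c j \<noteq> 0" "\<And>g. g \<in> G \<Longrightarrow> (\<Sum>j\<in>J. c j * a j g) = 0"
  using assms
proof (induction G arbitrary: J a thesis rule: finite_induct)
  case empty
  then obtain j where "j \<in> J" by (auto simp: card_gt_0_iff)
  then show ?case using empty(1)[of j "\<lambda>_. 1"] by simp
next
  case (insert g G)
  show ?case
  proof (cases "\<forall>j\<in>J. a j g = 0")
    case True
    have "card G < card J" using insert by simp
    with insert.IH[of J a] insert.prems(2) obtain c j where
      "j \<in> J" "c j \<noteq> 0" "\<And>g. g \<in> G \<Longrightarrow> (\<Sum>j\<in>J. c j * a j g) = 0" by metis
    with True show ?thesis by (intro insert.prems(1)[of j c]) auto
  next
    case False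
    then obtain i where i: "i \<in> J" "a i g \<noteq> 0" by blast
    \<comment> \<open>Pivoting on \<open>a i g\<close>: the unknown \<open>i\<close> is eliminated
      with equation \<open>g\<close>, so that \<open>b j g = 0\<close> for every
      \<open>j\<close>.\<close>
    define b where "b j h = a j h - a j g / a i g * a i h" for j h
    have "card G < card (J - {i})" using insert i by simp
    with insert.IH[of "J - {i}" b] insert.prems(2) obtain c j where
      c: "j \<in> J - {i}" "c j \<noteq> 0" "\<And>g. g \<in> G \<Longrightarrow> (\<Sum>j\<in>J - {i}. c j * b j g) = 0"
      by (metis finite_Diff)
    \<comment> \<open>The value at the pivot \<open>i\<close> is forced by equation
      \<open>g\<close>.\<close>
    define d where "d = c(i := - (\<Sum>j\<in>J - {i}. c j * a j g) / a i g)"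
    have d: "(\<Sum>j\<in>J. d j * a j h) = d i * a i h + (\<Sum>j\<in>J - {i}. c j * a j h)" for h
      using i(1) insert.prems(2) by (subst sum.remove[of J i]) (auto simp: d_def intro!: sum.cong)
    have "(\<Sum>j\<in>J. d j * a j h) = 0" if "h \<in> insert g G" for h
    proof (cases "h = g")
      case True
      then show ?thesis using i by (subst d) (simp add: d_def)
    next
      case False
      then have "(\<Sum>j\<in>J - {i}. c j * b j h) = 0" using that c by blast
      then have "(\<Sum>j\<in>J - {i}. c j * a j h) = (\<Sum>j\<in>J - {i}. c j * a j g) * (a i h / a i g)"
        unfolding sum_distrib_right
        by (simp add: b_def algebra_simps sum_subtractf)
      then show ?thesis by (subst d) (simp add: d_def)
    qed
    then show ?thesis using c by (intro insert.prems(1)[of j d]) (auto simp: d_def)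
  qed
qed


section \<open>Evaluation of homogeneous components\<close>

text \<open>Evaluation at a point and evaluation of a single homogeneous component are both linear
  extensions of functions on monomials, so linearity and the product formula are proved once,
  here.\<close>

definition lin_ext :: "('b \<Rightarrow> 'a::comm_ring_1) \<Rightarrow> ('b \<Rightarrow>\<^sub>0 'a) \<Rightarrow> 'a" where
  "lin_ext \<phi> f = (\<Sum>t\<in>Poly_Mapping.keys f. Poly_Mapping.lookup f t * \<phi> t)"

lemma lin_ext_superset:
  assumes "finite A" "Poly_Mapping.keys f \<subseteq> A"
  shows "lin_ext \<phi> f = (\<Sum>t\<in>A. Poly_Mapping.lookup f t * \<phi> t)"
  unfolding lin_ext_def using assms
  by (intro sum.mono_neutral_left) (auto simp: in_keys_iff)

lemma lin_ext_zero [simp]: "lin_ext \<phi> 0 = 0"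
  by (simp add: lin_ext_def)

lemma lin_ext_add: "lin_ext \<phi> (f + g) = lin_ext \<phi> f + lin_ext \<phi> g"
proof -
  let ?A = "Poly_Mapping.keys f \<union> Poly_Mapping.keys g"
  have "Poly_Mapping.keys (f + g) \<subseteq> ?A" by (rule keys_add)
  then show ?thesis
    by (simp add: lin_ext_superset[of ?A] lookup_add algebra_simps sum.distrib)
qed

lemma lin_ext_diff: "lin_ext \<phi> (f - g) = lin_ext \<phi> f - lin_ext \<phi> g"
  using lin_ext_add[of \<phi> "f - g" g] by simp

lemma lin_ext_sum: "lin_ext \<phi> (\<Sum>i\<in>A. f i) = (\<Sum>i\<in>A. lin_ext \<phi> (f i))"
  by (induction A rule: infinite_finite_induct) (simp_all add: lin_ext_add)

lemma lin_ext_single [simp]: "lin_ext \<phi> (Poly_Mapping.single t c) = c * \<phi> t"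
  by (simp add: lin_ext_def)

lemma sum_single_keys:
  "(\<Sum>t\<in>Poly_Mapping.keys f. Poly_Mapping.single t (Poly_Mapping.lookup f t)) = f"
  by (rule poly_mapping_eqI)
    (simp add: lookup_sum lookup_single when_def in_keys_iff sum.delta)

lemma lin_ext_mult:
  "lin_ext \<phi> (f * g) = (\<Sum>s\<in>Poly_Mapping.keys f. \<Sum>t\<in>Poly_Mapping.keys g.
     Poly_Mapping.lookup f s * Poly_Mapping.lookup g t * \<phi> (s + t))"
proof -
  have "lin_ext \<phi> (f * g) = lin_ext \<phi>
      ((\<Sum>s\<in>Poly_Mapping.keys f. Poly_Mapping.single s (Poly_Mapping.lookup f s)) *
       (\<Sum>t\<in>Poly_Mapping.keys g. Poly_Mapping.single t (Poly_Mapping.lookup g t)))"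
    by (simp add: sum_single_keys)
  then show ?thesis by (simp add: sum_product lin_ext_sum mult_single)
qed

lemma lin_ext_scale: "lin_ext \<phi> (scale c f) = c * lin_ext \<phi> f"
proof (cases "c = 0")
  case True then show ?thesis by (simp add: scale_def)
next
  case False
  then show ?thesis unfolding scale_def lin_ext_mult
    by (simp add: lin_ext_def sum_distrib_left mult.assoc)
qed

section \<open>Values of monomials at points\<close>

definition mon_val :: "'k::finite mon \<Rightarrow> ('k \<Rightarrow> 'a::comm_ring_1 ^ 2) \<Rightarrow> 'a" where
  "mon_val t u = (\<Prod>l\<in>UNIV. \<Prod>m\<in>UNIV. (u l $ m) ^ Poly_Mapping.lookup t (l, m))"

lemma mon_val_zero [simp]: "mon_val 0 u = 1"
  by (simp add: mon_val_def)

lemma mon_val_add: "mon_val (s + t) u = mon_val s u * mon_val t u"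
  by (simp add: mon_val_def lookup_add power_add prod.distrib)

lemma mon_val_single [simp]: "mon_val (Poly_Mapping.single (l, m) n) u = (u l $ m) ^ n"
proof -
  have "mon_val (Poly_Mapping.single (l, m) n) u =
      (\<Prod>l'\<in>UNIV. \<Prod>m'\<in>UNIV. if l' = l \<and> m' = m then (u l $ m) ^ n else 1)"
    unfolding mon_val_def by (intro prod.cong) (auto simp: lookup_single when_def)
  also have "\<dots> = (\<Prod>l'\<in>UNIV. if l' = l then (u l $ m) ^ n else 1)"
    by (rule prod.cong) (auto simp: prod.delta)
  also have "\<dots> = (u l $ m) ^ n" by (simp add: prod.delta)
  finally show ?thesis .
qed

lemma eval_mpoly_eq: "eval_mpoly f u = lin_ext (\<lambda>t. mon_val t u) f"
  for f :: "('k::finite, 'a::comm_ring_1) mpoly"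
proof -
  have "(\<Prod>(l, m)\<in>Poly_Mapping.keys t. (u l $ m) ^ Poly_Mapping.lookup t (l, m)) = mon_val t u" for t
  proof -
    have "mon_val t u = (\<Prod>(l, m)\<in>UNIV. (u l $ m) ^ Poly_Mapping.lookup t (l, m))"
      by (simp add: mon_val_def prod.cartesian_product)
    also have "\<dots> = (\<Prod>(l, m)\<in>Poly_Mapping.keys t. (u l $ m) ^ Poly_Mapping.lookup t (l, m))"
      by (rule prod.mono_neutral_right) (auto simp: in_keys_iff)
    finally show ?thesis by simp
  qed
  then show ?thesis by (simp add: eval_mpoly_def lin_ext_def)
qed

lemma mdeg_add [simp]: "mdeg (s + t) = mdeg s + mdeg t"
  by (auto simp: mdeg_def lookup_add sum.distrib)

lemma mdeg_zero [simp]: "mdeg 0 = 0"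
  by (auto simp: mdeg_def)

lemma mdeg_single [simp]: "mdeg (Poly_Mapping.single (l, m) 1) = e_vec l"
  by (auto simp: mdeg_def lookup_single when_def)

text \<open>The coordinates in which \<open>t\<close> has degree 0 do not enter its value.
  Restricting the hypothesis to the others allows points that agree projectively in only some
  factors to be compared.\<close>

lemma mon_val_scaling:
  assumes "\<And>l. mdeg t l \<noteq> 0 \<Longrightarrow> v l = c l *s u l"
  shows "mon_val t v = (\<Prod>l\<in>UNIV. c l ^ mdeg t l) * mon_val t u"
proof -
  have "(\<Prod>m\<in>UNIV. (v l $ m) ^ Poly_Mapping.lookup t (l, m)) =
     c l ^ mdeg t l * (\<Prod>m\<in>UNIV. (u l $ m) ^ Poly_Mapping.lookup t (l, m))" for l
  proof (cases "mdeg t l = 0")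
    case True
    then show ?thesis by (auto simp: mdeg_def)
  next
    case False
    then show ?thesis using assms[of l]
      by (simp add: power_mult_distrib prod.distrib mdeg_def power_sum)
  qed
  then show ?thesis by (simp add: mon_val_def prod.distrib)
qed

text \<open>The value at \<open>u\<close> of the component of \<open>f\<close> of multidegree
  \<open>j\<close>. Generators of the ideal may be inhomogeneous, so such functionals are needed on
  all polynomials, not only on forms.\<close>

definition comp_val :: "('k::finite \<Rightarrow> nat) \<Rightarrow> ('k, 'a::comm_ring_1) mpoly \<Rightarrow> ('k \<Rightarrow> 'a ^ 2) \<Rightarrow> 'a" where
  "comp_val j f u = lin_ext (\<lambda>t. if mdeg t = j then mon_val t u else 0) f"

lemma finite_le_fun: "finite {i. i \<le> (j :: 'k::finite \<Rightarrow> nat)}"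
proof (rule finite_subset)
  show "{i. i \<le> j} \<subseteq> (\<Pi>\<^sub>E l\<in>UNIV. {..j l})" by (auto simp: le_fun_def)
qed (rule finite_PiE, auto)

lemma comp_val_mult:
  "comp_val j (f * g) u = (\<Sum>i | i \<le> j. comp_val (j - i) f u * comp_val i g u)"
proof -
  let ?a = "\<lambda>s. Poly_Mapping.lookup f s" and ?b = "\<lambda>t. Poly_Mapping.lookup g t"
  let ?v = "\<lambda>j t. if mdeg t = j then mon_val t u else 0"
  have split: "?v j (s + t) = (\<Sum>i | i \<le> j. ?v (j - i) s * ?v i t)" for s t
  proof -
    \<comment> \<open>Natural subtraction truncates: \<open>j - i\<close> is the complementary
      degree only in conjunction with \<open>i \<le> j\<close>.\<close>
    have "a = c - b \<and> b \<le> c \<longleftrightarrow> a + b = c" for a b c :: nat by auto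
    then have eq: "mdeg s = j - mdeg t \<and> mdeg t \<le> j \<longleftrightarrow> mdeg s + mdeg t = j"
      unfolding fun_eq_iff le_fun_def by (simp flip: all_conj_distrib)
    have "(\<Sum>i | i \<le> j. ?v (j - i) s * ?v i t) =
        (\<Sum>i | i \<le> j. if mdeg t = i then ?v (j - mdeg t) s * mon_val t u else 0)"
      by (rule sum.cong) auto
    also have "\<dots> = (if mdeg t \<le> j then ?v (j - mdeg t) s * mon_val t u else 0)"
      by (simp add: finite_le_fun)
    also have "\<dots> = ?v j (s + t)" using eq by (auto simp: mon_val_add)
    finally show ?thesis by simp
  qed
  have "comp_val j (f * g) u = (\<Sum>s\<in>Poly_Mapping.keys f. \<Sum>t\<in>Poly_Mapping.keys g.
     \<Sum>i | i \<le> j. (?a s * ?v (j - i) s) * (?b t * ?v i t))"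
    unfolding comp_val_def lin_ext_mult split sum_distrib_left
    by (intro sum.cong refl) (simp add: mult_ac)
  also have "\<dots> = (\<Sum>s\<in>Poly_Mapping.keys f. \<Sum>i | i \<le> j. \<Sum>t\<in>Poly_Mapping.keys g.
      (?a s * ?v (j - i) s) * (?b t * ?v i t))"
    by (intro sum.cong refl sum.swap)
  also have "\<dots> = (\<Sum>i | i \<le> j. \<Sum>s\<in>Poly_Mapping.keys f. \<Sum>t\<in>Poly_Mapping.keys g.
      (?a s * ?v (j - i) s) * (?b t * ?v i t))"
    by (rule sum.swap)
  finally show ?thesis by (simp only: comp_val_def lin_ext_def sum_product)
qed

lemma lin_ext_cong:
  "(\<And>t. t \<in> Poly_Mapping.keys f \<Longrightarrow> \<phi> t = \<psi> t) \<Longrightarrow> lin_ext \<phi> f = lin_ext \<psi> f"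
  by (simp add: lin_ext_def)

lemma comp_val_homog:
  "f \<in> homog i \<Longrightarrow> comp_val j f u = (if j = i then eval_mpoly f u else 0)"
  unfolding comp_val_def eval_mpoly_eq
  by (auto simp: homog_def intro!: lin_ext_cong) (auto simp: lin_ext_def)

lemma comp_val_scaling:
  assumes "\<And>l. j l \<noteq> 0 \<Longrightarrow> v l = c l *s u l"
  shows "comp_val j f v = (\<Prod>l\<in>UNIV. c l ^ j l) * comp_val j f u"
proof -
  have "mon_val t v = (\<Prod>l\<in>UNIV. c l ^ j l) * mon_val t u" if "mdeg t = j" for t
    using mon_val_scaling[of t v c u] assms that by blast
  then show ?thesis unfolding comp_val_def lin_ext_def sum_distrib_left
    by (intro sum.cong) (auto simp: mult_ac)
qed

text \<open>For \<open>j = 0\<close> the points are unconstrained: \<open>comp_val 0 f\<close> is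
  the constant term of \<open>f\<close>, whatever the point.\<close>

lemma comp_val_cong:
  "(\<And>l. j l \<noteq> 0 \<Longrightarrow> v l = u l) \<Longrightarrow> comp_val j f v = comp_val j f u"
  using comp_val_scaling[of j v "\<lambda>_. 1" u f] by simp

lemma eval_mult: "eval_mpoly (f * g) u = eval_mpoly f u * eval_mpoly g u"
  for f g :: "('k::finite, 'a::comm_ring_1) mpoly"
  unfolding eval_mpoly_eq lin_ext_mult unfolding lin_ext_def sum_product
  by (simp add: mon_val_add mult_ac)

lemma homog_mult:
  fixes f g :: "('k, 'a::comm_ring_1) mpoly"
  assumes "f \<in> homog i" "g \<in> homog j"
  shows "f * g \<in> homog (i + j)"
  using assms keys_mult[of f g] by (fastforce simp: homog_def)

lemma homog_diff:
  fixes f g :: "('k, 'a::comm_ring_1) mpoly"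
  assumes "f \<in> homog i" "g \<in> homog i"
  shows "f - g \<in> homog i"
  using assms keys_diff[of f g] by (fastforce simp: homog_def)

lemma subspace_homog: "module.subspace scale (homog i :: ('k, 'a::field) mpoly set)"
proof -
  interpret vector_space "scale :: 'a \<Rightarrow> ('k, 'a) mpoly \<Rightarrow> _" by (rule vector_space_scale)
  have "scale c f \<in> homog i" if "f \<in> homog i" for c and f :: "('k, 'a) mpoly"
  proof -
    have "Poly_Mapping.single 0 c \<in> homog (0 :: 'k \<Rightarrow> nat)" by (simp add: homog_def)
    from homog_mult[OF this that] show ?thesis by (simp add: scale_def)
  qed
  moreover have "f + g \<in> homog i" if "f \<in> homog i" "g \<in> homog i" for f g :: "('k, 'a) mpoly"
    using that keys_add[of f g] by (fastforce simp: homog_def)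
  moreover have "0 \<in> homog i" by (simp add: homog_def)
  ultimately show ?thesis unfolding subspace_def by blast
qed

section \<open>Monomials of total degree at most 2 on a line\<close>

lemma mon_split_variable:
  fixes t :: "'k::finite mon"
  assumes "sum (Poly_Mapping.lookup t) UNIV = Suc n"
  obtains l m t' where "t = Poly_Mapping.single (l, m) 1 + t'" "sum (Poly_Mapping.lookup t') UNIV = n"
proof -
  obtain l m where lm: "Poly_Mapping.lookup t (l, m) \<noteq> 0"
    using assms by (metis (no_types, lifting) nat.distinct(1) sum.neutral surj_pair)
  define t' where "t' = t - Poly_Mapping.single (l, m) 1"
  have t: "t = Poly_Mapping.single (l, m) 1 + t'"
    using lm by (intro poly_mapping_eqI) (auto simp: t'_def lookup_add lookup_minus lookup_single when_def)
  have "sum (Poly_Mapping.lookup t) UNIV = 1 + sum (Poly_Mapping.lookup t') UNIV"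
    by (subst t) (simp add: lookup_add sum.distrib lookup_single when_def)
  with t assms that show ?thesis by simp
qed

lemma sum_mdeg: "(\<Sum>l\<in>UNIV. mdeg t l) = sum (Poly_Mapping.lookup t) UNIV" for t :: "'k::finite mon"
  by (simp add: mdeg_def sum.cartesian_product)

text \<open>A monomial of total degree 2 is a product of two linear functions, hence a quadratic
  form in the point; this is the parallelogram law for it.\<close>

lemma mon_val_parallelogram:
  fixes u v :: "'k::finite \<Rightarrow> 'a::comm_ring_1 ^ 2"
  assumes "(\<Sum>l\<in>UNIV. mdeg t l) = 2"
  shows "mon_val t (u - v) = 2 * mon_val t u + 2 * mon_val t v - mon_val t (u + v)"
proof -
  obtain l m s where s: "t = Poly_Mapping.single (l, m) 1 + s" "sum (Poly_Mapping.lookup s) UNIV = 1"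
    using assms mon_split_variable[of t 1] unfolding sum_mdeg by auto
  obtain l' m' r where r: "s = Poly_Mapping.single (l', m') 1 + r" "sum (Poly_Mapping.lookup r) UNIV = 0"
    using s(2) mon_split_variable[of s 0] by auto
  from r(2) have "r = 0" by (auto intro!: poly_mapping_eqI)
  with s r show ?thesis by (simp add: mon_val_add algebra_simps)
qed

lemma mon_val_degree_1:
  fixes u v :: "'k::finite \<Rightarrow> 'a::comm_ring_1 ^ 2"
  assumes "(\<Sum>l\<in>UNIV. mdeg t l) = 1"
  shows "mon_val t (u - v) = mon_val t u - mon_val t v"
proof -
  obtain l m s where s: "t = Poly_Mapping.single (l, m) 1 + s" "sum (Poly_Mapping.lookup s) UNIV = 0"
    using assms mon_split_variable[of t 0] unfolding sum_mdeg by auto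
  from s(2) have "s = 0" by (auto intro!: poly_mapping_eqI)
  with s show ?thesis by (simp add: mon_val_add)
qed

text \<open>Restricted to the line \<open>s u + t v\<close>, a form of degree at most 2 is a binary form with three zeros.\<close>

lemma comp_val_low_degree:
  fixes u v :: "'k::finite \<Rightarrow> 'a::comm_ring_1 ^ 2"
  assumes "(\<Sum>l\<in>UNIV. i l) \<le> 2"
    and "comp_val i f u = 0" "comp_val i f v = 0" "comp_val i f (u + v) = 0"
  shows "comp_val i f (u - v) = 0"
proof -
  consider "(\<Sum>l\<in>UNIV. i l) = 0" | "(\<Sum>l\<in>UNIV. i l) = 1" | "(\<Sum>l\<in>UNIV. i l) = 2"
    using assms(1) by linarith
  then show ?thesis
  proof cases
    case 1
    then show ?thesis using comp_val_cong[of i "u - v" u f] assms(2) by simp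
  next
    case 2
    then have "comp_val i f (u - v) = comp_val i f u - comp_val i f v"
      unfolding comp_val_def lin_ext_def sum_subtractf[symmetric]
      by (intro sum.cong) (auto simp: mon_val_degree_1 algebra_simps)
    then show ?thesis using assms by simp
  next
    case 3
    then have "comp_val i f (u - v) = 2 * comp_val i f u + 2 * comp_val i f v - comp_val i f (u + v)"
      unfolding comp_val_def lin_ext_def sum_subtractf[symmetric] sum.distrib[symmetric] sum_distrib_left
      by (intro sum.cong) (auto simp: mon_val_parallelogram algebra_simps)
    then show ?thesis using assms by simp
  qed
qed


section \<open>Linear forms and pairs of vectors\<close>

definition det2 :: "'a::comm_ring_1 ^ 2 \<Rightarrow> 'a ^ 2 \<Rightarrow> 'a" where
  "det2 v w = v $ 0 * w $ 1 - v $ 1 * w $ 0"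

lemma vec2_eq_iff: "v = w \<longleftrightarrow> v $ 0 = w $ 0 \<and> v $ 1 = w $ 1" for v w :: "'a ^ 2"
proof -
  have "(\<forall>i :: 2. P i) \<longleftrightarrow> P 0 \<and> P 1" for P
    using UNIV_two by (metis UNIV_I insertE singletonD)
  then show ?thesis by (simp add: vec_eq_iff)
qed

lemma proj_rel_det2_zero:
  assumes "v \<noteq> 0" "w \<noteq> 0" "det2 v w = (0 :: 'a::field)"
  shows "proj_rel v w"
proof -
  have eq: "v $ 0 * w $ 1 = v $ 1 * w $ 0" using assms(3) by (simp add: det2_def)
  have "\<exists>c. w = c *s v"
  proof (cases "v $ 0 = 0")
    case True
    with assms(1) have "v $ 1 \<noteq> 0" by (simp add: vec2_eq_iff)
    with True eq show ?thesis by (intro exI[of _ "w $ 1 / v $ 1"]) (simp add: vec2_eq_iff)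
  next
    case False
    with eq show ?thesis by (intro exI[of _ "w $ 0 / v $ 0"]) (simp add: vec2_eq_iff field_simps)
  qed
  with assms show ?thesis by (auto simp: proj_rel_def)
qed

text \<open>Cramer's rule with the denominator cleared; it expresses the third point in terms of the
  first two.\<close>

lemma det2_cramer: "det2 v w *s z = det2 z w *s v + det2 v z *s w"
  by (simp add: vec2_eq_iff det2_def algebra_simps)

lemma det2_scale [simp]: "det2 (c *s v) w = c * det2 v w" "det2 v (c *s w) = c * det2 v w"
  by (simp_all add: det2_def algebra_simps)

lemma det2_add: "det2 (v + v') w = det2 v w + det2 v' w" "det2 v (w + w') = det2 v w + det2 v w'"
  by (simp_all add: det2_def algebra_simps)

lemma det2_self [simp]: "det2 v v = 0"
  by (simp add: det2_def)

lemma det2_swap: "det2 w v = - det2 v w"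
  by (simp add: det2_def)

text \<open>The determinant of the \<open>l\<close>-th pair of variables against \<open>v\<close>:
  over a field and for \<open>v \<noteq> 0\<close>, the linear form in these variables whose zeros
  are the multiples of \<open>v\<close>.\<close>

definition lin_form :: "'k::finite \<Rightarrow> 'a::comm_ring_1 ^ 2 \<Rightarrow> ('k, 'a) mpoly" where
  "lin_form l v = Poly_Mapping.single (Poly_Mapping.single (l, 0) 1) (v $ 1)
     - Poly_Mapping.single (Poly_Mapping.single (l, 1) 1) (v $ 0)"

lemma homog_lin_form: "lin_form l v \<in> homog (e_vec l)"
  unfolding lin_form_def by (rule homog_diff) (auto simp: homog_def simp del: One_nat_def)

lemma eval_lin_form [simp]: "eval_mpoly (lin_form l v) u = det2 (u l) v"
  unfolding lin_form_def eval_mpoly_eq lin_ext_diff by (simp add: det2_def mult.commute)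

lemma eval_diff: "eval_mpoly (f - g) u = eval_mpoly f u - eval_mpoly g u"
  for f g :: "('k::finite, 'a::comm_ring_1) mpoly"
  by (simp add: eval_mpoly_eq lin_ext_diff)


section \<open>Homogeneous coordinates\<close>

lemma abs_proj_line_eq_iff:
  assumes "v \<noteq> 0" "w \<noteq> 0"
  shows "abs_proj_line v = abs_proj_line w \<longleftrightarrow> (\<exists>c. c \<noteq> 0 \<and> w = c *s v)"
proof -
  have "proj_rel x x" if "x \<noteq> 0" for x :: "'a ^ 2"
    using that by (auto simp: proj_rel_def intro: exI[of _ 1])
  then show ?thesis
    using Quotient3_rel[OF Quotient3_proj_line, of v w] assms by (auto simp: proj_rel_def)
qed

text \<open>\<open>proj_rel\<close> relates only nonzero vectors, so a representative, being related
  to itself, is nonzero.\<close>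

lemma ex_homog_coords: "\<exists>u. homog_coords P u" for P :: "'k \<Rightarrow> 'a::field proj_line"
proof -
  have "rep_proj_line p \<noteq> 0 \<and> abs_proj_line (rep_proj_line p) = p" for p :: "'a proj_line"
    using Quotient3_abs_rep[OF Quotient3_proj_line, of p]
      Quotient3_rep_reflp[OF Quotient3_proj_line, of p] by (simp add: proj_rel_def)
  then have "homog_coords P (\<lambda>l. rep_proj_line (P l))" by (simp add: homog_coords_def)
  then show ?thesis by blast
qed

lemma homog_coords_scale:
  assumes "homog_coords P u" "\<And>l. c l \<noteq> 0"
  shows "homog_coords P (\<lambda>l. c l *s u l)"
proof -
  have "u l \<noteq> 0" "abs_proj_line (u l) = P l" for l
    using assms(1) by (auto simp: homog_coords_def)
  moreover from this have "c l *s u l \<noteq> 0" for l using assms(2) by simp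
  ultimately show ?thesis
    unfolding homog_coords_def using assms(2) by (metis abs_proj_line_eq_iff)
qed

text \<open>In the factors that occur in the degree \<open>i\<close>, \<open>v\<close> is a
  rescaling of \<open>u\<close>, which multiplies the value by a constant. With \<open>P = Q\<close>
  this is independence of the choice of coordinates; with \<open>i\<close> a multiple of
  \<open>e_vec l\<close> it transfers zeros between points that share only the \<open>l\<close>-th
  coordinate.\<close>

lemma eval_eq_zero_coords:
  fixes f :: "('k::finite, 'a::field) mpoly"
  assumes "f \<in> homog i" "eval_mpoly f u = 0" "homog_coords P u" "homog_coords Q v"
    and "\<And>l. i l \<noteq> 0 \<Longrightarrow> P l = Q l"
  shows "eval_mpoly f v = 0"
proof -
  have "\<exists>c. i l \<noteq> 0 \<longrightarrow> v l = c *s u l" for l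
    using assms(3-5) by (metis abs_proj_line_eq_iff homog_coords_def)
  then obtain c where "\<And>l. i l \<noteq> 0 \<Longrightarrow> v l = c l *s u l" by metis
  from comp_val_scaling[of i v c u f, OF this] show ?thesis
    using assms(1,2) by (simp add: comp_val_homog)
qed

lemma vanishes_at_coords:
  fixes f :: "('k::finite, 'a::field) mpoly"
  assumes "f \<in> homog i" "homog_coords P u"
  shows "vanishes_at f P \<longleftrightarrow> eval_mpoly f u = 0"
  using assms eval_eq_zero_coords[OF assms(1)] by (auto simp: vanishes_at_def)


section \<open>The vanishing ideal and its generators\<close>

lemma vanishing_idealI:
  fixes f :: "('k, 'a::field) mpoly"
  assumes "f \<in> homog i" "\<And>P. P \<in> X \<Longrightarrow> vanishes_at f P"
  shows "f \<in> vanishing_ideal X"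
  unfolding vanishing_ideal_def ideal_gen_def
  by (rule module.span_base[OF module_mult]) (use assms in auto)

text \<open>The polynomials all of whose components vanish at \<open>u\<close> form an ideal, by the
  product formula, and this ideal contains the generating forms.\<close>

lemma vanishing_ideal_comp_val:
  fixes f :: "('k::finite, 'a::field) mpoly"
  assumes "f \<in> vanishing_ideal X" "P \<in> X" "homog_coords P u"
  shows "comp_val i f u = 0"
proof -
  interpret module "(*) :: ('k, 'a) mpoly \<Rightarrow> _" by (rule module_mult)
  let ?K = "{f :: ('k, 'a) mpoly. \<forall>i. comp_val i f u = 0}"
  have "subspace ?K"
    by (auto simp: subspace_def comp_val_mult) (simp_all add: comp_val_def lin_ext_add)
  moreover have "{f. (\<exists>i. f \<in> homog i) \<and> (\<forall>P\<in>X. vanishes_at f P)} \<subseteq> ?K"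
    using assms(2,3) by (auto simp: comp_val_homog vanishes_at_def)
  ultimately have "vanishing_ideal X \<subseteq> ?K"
    unfolding vanishing_ideal_def ideal_gen_def by (intro span_minimal)
  with assms(1) show ?thesis by blast
qed

section \<open>Quotient dimensions and normalised coordinates of the three points\<close>

lemma subspace_vanishing_ideal:
  "module.subspace scale (vanishing_ideal X :: ('k, 'a::field) mpoly set)"
proof -
  interpret V: vector_space "scale :: 'a \<Rightarrow> ('k, 'a) mpoly \<Rightarrow> _" by (rule vector_space_scale)
  interpret M: module "(*) :: ('k, 'a) mpoly \<Rightarrow> _" by (rule module_mult)
  show ?thesis
    unfolding V.subspace_def vanishing_ideal_def ideal_gen_def
    by (auto simp: scale_def intro: M.span_zero M.span_add M.span_scale)
qed

text \<open>Since \<open>quotient_dim\<close> is defined by choice, its value says something only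
  once a quotient basis exists. A basis \<open>C\<close> of \<open>V \<inter> W\<close> is extended
  to a basis \<open>D\<close> of \<open>V\<close>; the added vectors \<open>D - C\<close> form a
  basis modulo \<open>W\<close>.\<close>

lemma ex_quotient_basis:
  fixes V W :: "('k, 'a::field) mpoly set"
  assumes "module.subspace scale V" "module.subspace scale W"
  shows "\<exists>B. quotient_basis V W B"
proof -
  interpret vector_space "scale :: 'a \<Rightarrow> ('k, 'a) mpoly \<Rightarrow> _" by (rule vector_space_scale)
  obtain C where C: "C \<subseteq> V \<inter> W" "independent C" "V \<inter> W \<subseteq> span C"
    by (rule maximal_independent_subset)
  obtain D where D: "C \<subseteq> D" "D \<subseteq> V" "independent D" "V \<subseteq> span D"
    using C maximal_independent_subset_extend[of C V] by auto
  have "quotient_basis V W (D - C)"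
    unfolding quotient_basis_def
  proof (intro conjI allI impI ballI)
    show "D - C \<subseteq> V" using D by blast
  next
    fix T c b
    assume T: "finite T" "T \<subseteq> D - C" "(\<Sum>b\<in>T. scale (c b) b) \<in> W" and b: "b \<in> T"
    have "(\<Sum>b\<in>T. scale (c b) b) \<in> V"
      by (rule subspace_sum[OF assms(1)]) (use T D in \<open>blast intro: subspace_scale[OF assms(1)]\<close>)
    with T C have "(\<Sum>b\<in>T. scale (c b) b) \<in> span C" by blast
    then obtain S r where S: "finite S" "S \<subseteq> C"
      "(\<Sum>b\<in>T. scale (c b) b) = (\<Sum>b\<in>S. scale (r b) b)"
      unfolding span_explicit by auto
    \<comment> \<open>\<open>T\<close> and \<open>S\<close> are disjoint, so these coefficients turn
      the equality of the two sums into one relation on \<open>D\<close>.\<close>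
    let ?q = "\<lambda>b. if b \<in> T then c b else - r b"
    have "(\<Sum>b\<in>T \<union> S. scale (?q b) b) = (\<Sum>b\<in>T. scale (?q b) b) + (\<Sum>b\<in>S. scale (?q b) b)"
      using S T by (intro sum.union_disjoint) auto
    also have "(\<Sum>b\<in>S. scale (?q b) b) = - (\<Sum>b\<in>S. scale (r b) b)"
      unfolding sum_negf[symmetric] using S T by (intro sum.cong) auto
    finally have "(\<Sum>b\<in>T \<union> S. scale (?q b) b) = 0" using S by simp
    moreover have "finite (T \<union> S)" "T \<union> S \<subseteq> D" "b \<in> T \<union> S" using S T D b by auto
    ultimately have "?q b = 0" by (intro independentD[OF D(3), of "T \<union> S" ?q b])
    with b show "c b = 0" by simp
  next
    fix v assume "v \<in> V"
    then have "v \<in> span (C \<union> (D - C))" using D by (auto simp: Un_absorb1)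
    then obtain x y where "v = x + y" "x \<in> span C" "y \<in> span (D - C)"
      unfolding span_Un by blast
    moreover have "span C \<subseteq> W" by (rule span_minimal) (use C assms in auto)
    ultimately show "\<exists>w\<in>span (D - C). v - w \<in> W" by (intro bexI[of _ y]) auto
  qed
  then show ?thesis ..
qed

text \<open>
  If two of the three points had the same \<open>l\<close>-th coordinate, the points would impose only
  two conditions on forms of degree \<open>2 e\<^sub>l\<close>.
\<close>

lemma generic_position_coords_distinct:
  fixes X :: "('k::finite \<Rightarrow> 'a::field proj_line) set"
  assumes "generic_position X" "card X = 3" "P \<in> X" "Q \<in> X" "P \<noteq> Q"
  shows "P l \<noteq> Q l"
proof
  assume PQ: "P l = Q l"
  interpret vector_space "scale :: 'a \<Rightarrow> ('k, 'a) mpoly \<Rightarrow> _" by (rule vector_space_scale)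
  \<comment> \<open>Degree \<open>2 e_l\<close> has exactly three monomials, so three generic points
    admit no nonzero form of this degree in their ideal.\<close>
  let ?I = "vanishing_ideal X" and ?i = "e_vec l + e_vec l"
  have "N_dim ?i = (\<Prod>l'\<in>UNIV. if l' = l then 3 else 1)"
    unfolding N_dim_def by (rule prod.cong) auto
  then have "N_dim ?i = 3" by simp
  then have 3: "hilbert_fun ?I ?i = 3"
    using assms(1,2) by (simp add: generic_position_def)
  define B where "B = (SOME B. quotient_basis (homog ?i) ?I B)"
  have B: "quotient_basis (homog ?i) ?I B" "card B = 3"
    using 3 someI_ex[OF ex_quotient_basis[OF subspace_homog subspace_vanishing_ideal]]
    by (simp_all add: B_def hilbert_fun_def quotient_dim_def)
  then have fin: "finite B" by (metis card.infinite zero_neq_numeral)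
  \<comment> \<open>Leaving out \<open>Q\<close> gives two linear conditions on three coefficients;
    vanishing at \<open>Q\<close> is then inherited from \<open>P\<close>.\<close>
  have "card (X - {Q}) = 2" using assms by simp
  moreover have "finite X" using assms(2) by (metis card.infinite zero_neq_numeral)
  ultimately have less: "finite (X - {Q})" "card (X - {Q}) < card B" using B by auto
  obtain c b where c: "b \<in> B" "c b \<noteq> 0"
    "\<And>P. P \<in> X - {Q} \<Longrightarrow> (\<Sum>b\<in>B. c b * eval_mpoly b (SOME u. homog_coords P u)) = 0"
    by (rule nontrivial_relation[OF less(1) fin less(2),
          of "\<lambda>b P. eval_mpoly b (SOME u. homog_coords P u)"]) blast
  let ?f = "\<Sum>b\<in>B. scale (c b) b"
  have f: "?f \<in> homog ?i"
    by (rule subspace_sum[OF subspace_homog])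
      (use B(1) in \<open>auto simp: quotient_basis_def intro!: subspace_scale[OF subspace_homog]\<close>)
  have van: "vanishes_at ?f R" if R: "R \<in> X - {Q}" for R
  proof -
    have "eval_mpoly ?f (SOME u. homog_coords R u) = 0"
      using c(3)[OF R] by (simp add: eval_mpoly_eq lin_ext_sum lin_ext_scale)
    then show ?thesis
      using vanishes_at_coords[OF f someI_ex[OF ex_homog_coords]] by blast
  qed
  have "vanishes_at ?f Q"
    unfolding vanishes_at_def
  proof (intro allI impI)
    fix v assume v: "homog_coords Q v"
    obtain u where u: "homog_coords P u" using ex_homog_coords by blast
    have "eval_mpoly ?f u = 0" using van[of P] assms u by (simp add: vanishes_at_def)
    from eval_eq_zero_coords[OF f this u v] PQ show "eval_mpoly ?f v = 0"
      by (auto split: if_splits)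
  qed
  with van have "?f \<in> ?I" by (intro vanishing_idealI[OF f]) blast
  with B(1) fin c show False unfolding quotient_basis_def by blast
qed

text \<open>As the coordinates are pairwise distinct, \<open>w l\<close> is a combination of the
  independent vectors \<open>u l\<close> and \<open>v l\<close> with both coefficients nonzero.
  Absorbing the coefficients into the representatives makes the third vector the sum of the first
  two.\<close>

lemma generic_position_coords:
  fixes X :: "('k::finite \<Rightarrow> 'a::field proj_line) set"
  assumes "generic_position X" "card X = 3"
  obtains P Q R u v where "X = {P, Q, R}"
    "homog_coords P u" "homog_coords Q v" "homog_coords R (u + v)" "\<And>l. det2 (u l) (v l) \<noteq> 0"
proof -
  obtain P Q R where X: "X = {P, Q, R}" "P \<noteq> Q" "P \<noteq> R" "Q \<noteq> R"
    using assms(2) by (auto simp: card_3_iff)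
  obtain u v w where uvw: "homog_coords P u" "homog_coords Q v" "homog_coords R w"
    using ex_homog_coords by metis
  have indep: "det2 (x l) (y l) \<noteq> 0"
    if "homog_coords S x" "homog_coords T y" "S \<in> X" "T \<in> X" "S \<noteq> T" for S T x y l
  proof
    assume "det2 (x l) (y l) = 0"
    then have "proj_rel (x l) (y l)"
      using that by (intro proj_rel_det2_zero) (auto simp: homog_coords_def)
    then obtain c where "c \<noteq> 0" "y l = c *s x l" "x l \<noteq> 0" "y l \<noteq> 0"
      by (auto simp: proj_rel_def)
    then have "abs_proj_line (x l) = abs_proj_line (y l)"
      using abs_proj_line_eq_iff by blast
    then have "S l = T l" using that by (simp add: homog_coords_def)
    then show False using generic_position_coords_distinct[OF assms] that by blast
  qed
  \<comment> \<open>Cramer's coefficients: \<open>w l\<close> equals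
    \<open>a l *s u l + b l *s v l\<close>.\<close>
  define a b where "a l = det2 (w l) (v l) / det2 (u l) (v l)"
    and "b l = det2 (u l) (w l) / det2 (u l) (v l)" for l
  have uv: "det2 (u l) (v l) \<noteq> 0" and "a l \<noteq> 0" "b l \<noteq> 0" for l
    using indep[OF uvw(1,2)] indep[OF uvw(1,3)] indep[OF uvw(3,2)] X by (auto simp: a_def b_def)
  then have hc: "homog_coords P (\<lambda>l. a l *s u l)" "homog_coords Q (\<lambda>l. b l *s v l)"
    and ab: "det2 (a l *s u l) (b l *s v l) \<noteq> 0" for l
    using uvw by (auto intro: homog_coords_scale)
  have "(\<lambda>l. a l *s u l) + (\<lambda>l. b l *s v l) = w"
  proof
    fix l
    have "inverse (det2 (u l) (v l)) *s (det2 (u l) (v l) *s w l) = a l *s u l + b l *s v l"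
      unfolding det2_cramer[of "u l" "v l" "w l"]
      by (simp add: vec2_eq_iff a_def b_def field_simps add_divide_distrib)
    then show "((\<lambda>l. a l *s u l) + (\<lambda>l. b l *s v l)) l = w l"
      using uv by (simp add: vector_smult_assoc)
  qed
  with that[OF X(1) hc] ab uvw show thesis by simp
qed


section \<open>Counting degrees\<close>

lemma N_dim_indicator: "N_dim (\<lambda>l. if l \<in> A then 1 else 0) = 2 ^ card A" for A :: "'k::finite set"
proof -
  have "N_dim (\<lambda>l. if l \<in> A then 1 else 0) = (\<Prod>l\<in>UNIV. if l \<in> A then 2 else 1)"
    unfolding N_dim_def by (rule prod.cong) auto
  then show ?thesis by (simp add: prod.If_cases)
qed

lemma N_dim_two_support:
  assumes "l \<noteq> m" "\<And>l'. l' \<noteq> l \<Longrightarrow> l' \<noteq> m \<Longrightarrow> i l' = 0"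
  shows "N_dim i = (i l + 1) * (i m + 1)"
proof -
  have "N_dim i = (\<Prod>l'\<in>{l, m}. i l' + 1)"
    unfolding N_dim_def using assms by (intro prod.mono_neutral_right) auto
  then show ?thesis using assms by simp
qed

lemma N_dim_one_support:
  assumes "\<And>l'. l' \<noteq> l \<Longrightarrow> i l' = 0"
  shows "N_dim i = i l + 1"
proof -
  have "N_dim i = (\<Prod>l'\<in>{l}. i l' + 1)"
    unfolding N_dim_def using assms by (intro prod.mono_neutral_right) auto
  then show ?thesis by simp
qed

lemma e_vec_sum_triple:
  assumes "card A = 3"
  obtains a b c where "a \<noteq> b" "a \<noteq> c" "b \<noteq> c" "A = {a, b, c}"
    "(\<lambda>l. if l \<in> A then 1 else 0) = e_vec a + e_vec b + e_vec c"
proof -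
  obtain a b c where "A = {a, b, c}" "a \<noteq> b" "a \<noteq> c" "b \<noteq> c"
    using assms by (auto simp: card_3_iff)
  then show thesis by (intro that[of a b c]) (auto simp: fun_eq_iff)
qed

lemma D_set_3_pair: "e_vec l + e_vec m \<in> {i. N_dim i > 3}" if "l \<noteq> m"
  using that N_dim_two_support[of l m "e_vec l + e_vec m"] by auto

lemma D_set_3_triple: "e_vec l + e_vec l + e_vec l \<in> {i. N_dim i > 3}"
  using N_dim_one_support[of l "e_vec l + e_vec l + e_vec l"] by auto

text \<open>If two coordinates of \<open>i\<close> are nonzero, \<open>i\<close> lies above some
  \<open>e_l + e_m\<close>; if only one is, \<open>N_dim i = i l + 1 > 3\<close> puts it above
  \<open>3 e_l\<close>. Minimality turns both into equalities.\<close>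

lemma D_set_3_cases:
  assumes "i \<in> D_set 3"
  obtains l where "i = e_vec l + e_vec l + e_vec l"
  | l m where "l \<noteq> m" "i = e_vec l + e_vec m"
proof -
  have min: "i = j" if "j \<in> {i. N_dim i > 3}" "j \<le> i" for j
    using assms that unfolding D_set_def min_elems_def by blast
  have N: "N_dim i > 3" using assms by (simp add: D_set_def min_elems_def)
  have "\<exists>l. i l \<noteq> 0"
  proof (rule ccontr)
    assume "\<not> ?thesis"
    then have "N_dim i = 1" by (simp add: N_dim_def)
    with N show False by simp
  qed
  then obtain l where l: "i l \<noteq> 0" by blast
  show thesis
  proof (cases "\<exists>m. m \<noteq> l \<and> i m \<noteq> 0")
    case True
    then obtain m where "m \<noteq> l" "i m \<noteq> 0" by blast
    then have "l \<noteq> m" "i m \<noteq> 0" by simp_all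
    moreover from this l have "e_vec l + e_vec m \<le> i" by (auto simp: le_fun_def)
    ultimately show ?thesis using min[OF D_set_3_pair] that(2) by blast
  next
    case False
    then have "i l \<ge> 3" using N_dim_one_support[of l i] N by fastforce
    then have "e_vec l + e_vec l + e_vec l \<le> i" by (auto simp: le_fun_def)
    then show ?thesis using min[OF D_set_3_triple] that(1) by blast
  qed
qed

lemma N_dim_D_set_3: "i \<in> D_set 3 \<Longrightarrow> N_dim i = 4"
proof (erule D_set_3_cases)
  fix l assume "i = e_vec l + e_vec l + e_vec l"
  then show "N_dim i = 4" using N_dim_one_support[of l i] by auto
next
  fix l m :: 'a assume "l \<noteq> m" "i = e_vec l + e_vec m"
  then show "N_dim i = 4" using N_dim_two_support[of l m i] by auto
qed

lemma pair_in_D_set_3: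
  assumes "l \<noteq> m"
  shows "e_vec l + e_vec m \<in> D_set 3"
  unfolding D_set_def min_elems_def
proof (intro CollectI conjI ballI impI)
  show "N_dim (e_vec l + e_vec m) > 3" using D_set_3_pair[OF assms] by simp
next
  fix j assume j: "j \<in> {i. N_dim i > 3}" "j \<le> e_vec l + e_vec m"
  then have le: "j l' \<le> (e_vec l + e_vec m) l'" for l' by (simp only: le_fun_def)
  have "j l' = 0" if "l' \<noteq> l" "l' \<noteq> m" for l' using le[of l'] that by simp
  then have "(j l + 1) * (j m + 1) > 3" using j N_dim_two_support[OF assms, of j] by simp
  moreover have "j l \<in> {0, 1}" "j m \<in> {0, 1}" using le[of l] le[of m] assms by auto
  ultimately have "j l = 1" "j m = 1" by auto
  then show "j = e_vec l + e_vec m"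
    using \<open>\<And>l'. l' \<noteq> l \<Longrightarrow> l' \<noteq> m \<Longrightarrow> j l' = 0\<close> assms by (auto simp: fun_eq_iff)
qed

section \<open>The degrees that force generators, and the bound on v(3; 1, ..., 1)\<close>

definition double_degrees :: "('k::finite \<Rightarrow> nat) set" where
  "double_degrees = {e_vec l + e_vec l + e_vec m | l m. l \<noteq> m}"

text \<open>The degrees \<open>e_a + e_b + e_c\<close> with distinct indices, encoded as indicators
  of 3-element sets so that their number is visibly a binomial coefficient.\<close>

definition triple_degrees :: "('k::finite \<Rightarrow> nat) set" where
  "triple_degrees = (\<lambda>A l. if l \<in> A then 1 else 0) ` {A. card A = 3}"

definition generator_degrees :: "('k::finite \<Rightarrow> nat) set" where
  "generator_degrees = D_set 3 \<union> double_degrees \<union> triple_degrees"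

lemma finite_double_degrees: "finite double_degrees"
proof -
  have "double_degrees \<subseteq> range (\<lambda>(l, m). e_vec l + e_vec l + e_vec m)"
    by (auto simp: double_degrees_def)
  then show ?thesis by (rule finite_subset) simp
qed

lemma N_dim_double_degrees: "j \<in> double_degrees \<Longrightarrow> N_dim j = 6"
  unfolding double_degrees_def
proof safe
  fix l m :: 'a assume "l \<noteq> m"
  then show "N_dim (e_vec l + e_vec l + e_vec m) = 6"
    using N_dim_two_support[of l m "e_vec l + e_vec l + e_vec m"] by auto
qed

lemma N_dim_triple_degrees: "j \<in> triple_degrees \<Longrightarrow> N_dim j = 8"
  unfolding triple_degrees_def by (auto simp: N_dim_indicator)

lemma card_triple_degrees: "card (triple_degrees :: ('k::finite \<Rightarrow> nat) set) = CARD('k) choose 3"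
proof -
  have "inj_on (\<lambda>A l. if l \<in> A then 1 else 0 :: nat) {A :: 'k set. card A = 3}"
    by (auto simp: inj_on_def fun_eq_iff split: if_splits)
  moreover have "card {A :: 'k set. card A = 3} = CARD('k) choose 3"
    using n_subsets[of "UNIV :: 'k set" 3] by simp
  ultimately show ?thesis by (simp add: triple_degrees_def card_image)
qed

lemma finite_triple_degrees: "finite (triple_degrees :: ('k::finite \<Rightarrow> nat) set)"
  by (simp add: triple_degrees_def)

lemma finite_generator_degrees: "finite (generator_degrees :: ('k::finite \<Rightarrow> nat) set)"
  unfolding generator_degrees_def
  by (intro finite_UnI finite_D_set finite_double_degrees finite_triple_degrees)

text \<open>The three families are disjoint because \<open>N_dim\<close> is 4, 6 and 8 on
  them.\<close>

lemma card_generator_degrees: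
  "card (generator_degrees :: ('k::finite \<Rightarrow> nat) set) =
     card (D_set 3 :: ('k \<Rightarrow> nat) set) + card (double_degrees :: ('k \<Rightarrow> nat) set) + (CARD('k) choose 3)"
proof -
  have "(D_set 3 :: ('k \<Rightarrow> nat) set) \<inter> double_degrees = {}"
    "(D_set 3 \<union> double_degrees :: ('k \<Rightarrow> nat) set) \<inter> triple_degrees = {}"
    using N_dim_D_set_3 N_dim_double_degrees N_dim_triple_degrees by fastforce+
  then show ?thesis unfolding generator_degrees_def
    by (simp add: card_Un_disjoint finite_D_set finite_double_degrees finite_triple_degrees
        card_triple_degrees)
qed

text \<open>Every \<open>l\<close> in \<open>L_set 3 j\<close> subtracts \<open>2 * (4 - 3)\<close>.
  The possible \<open>j\<close> are \<open>4 e_l\<close>, with at most 5 - 3 - 2 = 0 left;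
  \<open>2 e_l + e_m\<close>, with at most 6 - 3 - 2 = 1; and \<open>e_l + e_m + e_n\<close>, with
  at most 8 - 3 - 6 < 0.\<close>

lemma DD_set_3_contribution:
  fixes j :: "'k::finite \<Rightarrow> nat"
  assumes "j \<in> DD_set 3"
  shows "int (N_dim j) - 3 - (\<Sum>l\<in>L_set 3 j. 2 * (int (N_dim (j - e_vec l)) - 3))
    \<le> (if j \<in> double_degrees then 1 else 0)"
proof -
  have N4: "N_dim (j - e_vec l) = 4" if l: "l \<in> L_set 3 j" for l
  proof -
    from l obtain i where "i \<in> D_set 3" "j = i + e_vec l" by (auto simp: L_set_def D_shift_def)
    moreover from this have "j - e_vec l = i" by (auto simp: fun_eq_iff)
    ultimately show ?thesis using N_dim_D_set_3 by simp
  qed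
  have in_L: "l \<in> L_set 3 j" if "i \<in> D_set 3" "j = i + e_vec l" for i l
    using that by (auto simp: L_set_def D_shift_def)
  have sum: "(\<Sum>l\<in>L_set 3 j. 2 * (int (N_dim (j - e_vec l)) - 3)) = 2 * int (card (L_set 3 j))"
    using N4 by simp
  have card: "card A \<le> card (L_set 3 j)" if "A \<subseteq> L_set 3 j" for A
    using that by (intro card_mono) auto
  from assms obtain i n where i: "i \<in> D_set 3" and j: "j = i + e_vec n"
    by (auto simp: DD_set_def D_shift_def)
  have n: "{n} \<subseteq> L_set 3 j" using in_L[OF i j] by simp
  from i show ?thesis
  proof (cases rule: D_set_3_cases)
    case (1 l)
    \<comment> \<open>For \<open>n \<noteq> l\<close> the degree \<open>3 e_l + e_n\<close> exceeds
      \<open>e_l + e_n\<close> by \<open>2 e_l\<close>, so it has been removed from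
      \<open>DD_set 3\<close>.\<close>
    have "n = l"
    proof (rule ccontr)
      assume "n \<noteq> l"
      then have "e_vec l + e_vec n \<in> D_set 3" by (intro pair_in_D_set_3) auto
      moreover have "j \<in> DD_at (e_vec l + e_vec n)"
      proof -
        have "j l = 3" using 1 j \<open>n \<noteq> l\<close> by simp
        then have "j l \<noteq> (e_vec l + e_vec n) l" "j l \<noteq> (e_vec l + e_vec n + e_vec l') l" for l'
          using \<open>n \<noteq> l\<close> by auto
        then have "j \<noteq> e_vec l + e_vec n" "j \<noteq> e_vec l + e_vec n + e_vec l'" for l'
          by metis+
        then show ?thesis using 1 j by (auto simp: DD_at_def le_fun_def)
      qed
      ultimately show False using assms by (auto simp: DD_set_def)
    qed
    then have "N_dim j = 5" using 1 j N_dim_one_support[of l j] by auto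
    then show ?thesis using card[OF n] unfolding sum by simp
  next
    case (2 l m)
    show ?thesis
    proof (cases "n \<in> {l, m}")
      case True
      then have "j = e_vec l + e_vec l + e_vec m \<or> j = e_vec m + e_vec m + e_vec l"
        using 2 j by (auto simp: add_ac)
      then have "j \<in> double_degrees" using 2 by (auto simp: double_degrees_def)
      then show ?thesis using card[OF n] N_dim_double_degrees[of j] unfolding sum by simp
    next
      case False
      let ?A = "{l, m, n}"
      have A: "card ?A = 3" using 2 False by auto
      have "j = (\<lambda>l'. if l' \<in> ?A then 1 else 0)" using 2 j False by (auto simp: fun_eq_iff)
      then have "N_dim j = 8" using N_dim_indicator[of ?A] A by simp
      \<comment> \<open>Any of the three indices can be the one added last, since the other two form
        a pair in \<open>D_set 3\<close>.\<close>
      moreover have "?A \<subseteq> L_set 3 j"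
      proof -
        have "e_vec m + e_vec n \<in> D_set 3" "e_vec l + e_vec n \<in> D_set 3"
          using False by (auto intro!: pair_in_D_set_3)
        moreover have "j = (e_vec m + e_vec n) + e_vec l" "j = (e_vec l + e_vec n) + e_vec m"
          using 2 j by (simp_all add: add_ac)
        ultimately have "l \<in> L_set 3 j" "m \<in> L_set 3 j" using in_L by blast+
        with n show ?thesis by simp
      qed
      from card[OF this] A have "card (L_set 3 j) \<ge> 3" by simp
      ultimately show ?thesis unfolding sum by simp
    qed
  qed
qed

text \<open>Each degree in \<open>D_set 3\<close> contributes 4 - 3 = 1 to the first sum; in the
  second sum only double degrees can contribute, each at most 1.\<close>

lemma v_num_3_le:
  "v_num TYPE('k::finite) 3 \<le>
     int (card (D_set 3 :: ('k \<Rightarrow> nat) set) + card (double_degrees :: ('k \<Rightarrow> nat) set))"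
proof -
  have "(\<Sum>j\<in>(DD_set 3 :: ('k \<Rightarrow> nat) set).
        max 0 (int (N_dim j) - 3 - (\<Sum>l\<in>L_set 3 j. 2 * (int (N_dim (j - e_vec l)) - 3))))
      \<le> (\<Sum>j\<in>(DD_set 3 :: ('k \<Rightarrow> nat) set). if j \<in> double_degrees then 1 else 0)"
    using DD_set_3_contribution by (intro sum_mono) force
  also have "\<dots> = int (card (DD_set 3 \<inter> double_degrees :: ('k \<Rightarrow> nat) set))"
    by (simp add: sum.If_cases finite_DD_set)
  also have "\<dots> \<le> int (card (double_degrees :: ('k \<Rightarrow> nat) set))"
    by (simp add: card_mono finite_double_degrees)
  finally show ?thesis by (simp add: v_num_def N_dim_D_set_3)
qed

text \<open>The two shapes correspond to the two kinds of separating functional. In the first the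
  indices may coincide, which covers \<open>3 e_l\<close> and the double degrees.\<close>

lemma generator_degrees_cases:
  assumes "j \<in> generator_degrees"
  obtains a b c where "j = e_vec a + e_vec b + e_vec c"
  | a b where "a \<noteq> b" "j = e_vec a + e_vec b"
  using assms unfolding generator_degrees_def double_degrees_def triple_degrees_def
  by (auto elim!: D_set_3_cases e_vec_sum_triple)


section \<open>Separating functionals\<close>

lemma sum_less_fun:
  fixes i j :: "'k::finite \<Rightarrow> nat"
  assumes "i \<le> j" "i \<noteq> j"
  shows "(\<Sum>l\<in>UNIV. i l) < (\<Sum>l\<in>UNIV. j l)"
proof -
  obtain l where "i l < j l" using assms by (metis ext le_fun_def order_le_imp_less_or_eq)
  with assms(1) show ?thesis by (intro sum_strict_mono_ex1) (auto simp: le_fun_def)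
qed

text \<open>The last condition makes the map from \<open>q\<close> to \<open>comp_val j q p\<close>
  vanish on every product of an element of the ideal with a polynomial without constant term, while
  \<open>f\<close> shows that it is nonzero on the ideal.\<close>

lemma ex_separating_functional:
  fixes X :: "('k::finite \<Rightarrow> 'a::field_char_0 proj_line) set"
  assumes "generic_position X" "card X = 3" "j \<in> generator_degrees"
  shows "\<exists>p f. f \<in> vanishing_ideal X \<and> f \<in> homog j \<and> eval_mpoly f p \<noteq> 0 \<and>
    (\<forall>g\<in>vanishing_ideal X. \<forall>i. i \<le> j \<longrightarrow> i \<noteq> j \<longrightarrow> comp_val i g p = 0)"
proof -
  obtain P Q R u v where X: "X = {P, Q, R}"
    and uv: "homog_coords P u" "homog_coords Q v" "homog_coords R (u + v)"
    and det: "\<And>l. det2 (u l) (v l) \<noteq> 0"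
    by (rule generic_position_coords[OF assms(1,2)]) blast
  have I: "comp_val i g u = 0" "comp_val i g v = 0" "comp_val i g (u + v) = 0"
    if "g \<in> vanishing_ideal X" for g i
    using vanishing_ideal_comp_val[OF that] X uv by auto
  have in_I: "f \<in> vanishing_ideal X"
    if "f \<in> homog j" "eval_mpoly f u = 0" "eval_mpoly f v = 0" "eval_mpoly f (u + v) = 0" for f
    using that uv X by (intro vanishing_idealI[of f j]) (auto simp: vanishes_at_coords)
  from assms(3) show ?thesis
  proof (cases rule: generator_degrees_cases)
    case (1 a b c)
    \<comment> \<open>One linear factor for each of the three points.\<close>
    let ?f = "lin_form a (u a) * lin_form b (v b) * lin_form c (u c + v c)"
    have f: "?f \<in> homog j" unfolding 1 by (intro homog_mult homog_lin_form)
    have "eval_mpoly ?f (u - v) \<noteq> 0"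
    proof -
      \<comment> \<open>Characteristic 0 enters here: the factor 2 must not vanish.\<close>
      have "det2 (u c - v c) (u c + v c) = 2 * det2 (u c) (v c)"
        by (simp add: det2_def algebra_simps)
      moreover have "det2 (u a - v a) (u a) = det2 (u a) (v a)"
        "det2 (u b - v b) (v b) = det2 (u b) (v b)"
        by (simp_all add: det2_def algebra_simps)
      ultimately show ?thesis using det by (simp add: eval_mult)
    qed
    moreover have "comp_val i g (u - v) = 0" if "g \<in> vanishing_ideal X" "i \<le> j" "i \<noteq> j" for g i
    proof -
      have "(\<Sum>l\<in>UNIV. i l) < (\<Sum>l\<in>UNIV. j l)" using that by (intro sum_less_fun)
      also have "\<dots> = 3" unfolding 1 plus_fun_apply sum.distrib sum_e_vec by simp
      finally have "(\<Sum>l\<in>UNIV. i l) \<le> 2" by simp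
      then show ?thesis using I[OF that(1)] by (intro comp_val_low_degree) auto
    qed
    moreover have "?f \<in> vanishing_ideal X" by (rule in_I[OF f]) (simp_all add: eval_mult)
    ultimately show ?thesis using f by blast
  next
    case (2 a b)
    \<comment> \<open>At \<open>u\<close> and at \<open>v\<close> each product has a zero factor; at
      \<open>u + v\<close> the two products are equal and cancel.\<close>
    let ?f = "lin_form a (v a) * lin_form b (u b) - lin_form a (u a) * lin_form b (v b)"
    \<comment> \<open>Mixing the coordinates \<open>u a\<close> and \<open>v b\<close> kills the
      second product but not the first.\<close>
    let ?p = "v(a := u a)"
    have f: "?f \<in> homog j" unfolding 2 by (intro homog_diff homog_mult homog_lin_form)
    have "eval_mpoly ?f ?p \<noteq> 0"
      using det 2 det2_swap[of "v b" "u b"] by (simp add: eval_diff eval_mult)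
    moreover have "comp_val i g ?p = 0" if g: "g \<in> vanishing_ideal X" and "i \<le> j" "i \<noteq> j" for g i
    proof -
      have le: "i l \<le> (e_vec a + e_vec b) l" for l
        using \<open>i \<le> j\<close> by (simp only: 2 le_fun_def)
      have zero: "i l = 0" if "l \<noteq> a" "l \<noteq> b" for l
        using le[of l] that by simp
      \<comment> \<open>A degree strictly below \<open>e_a + e_b\<close> involves only one of the
        two factors, where \<open>?p\<close> looks like \<open>u\<close> or like
        \<open>v\<close>.\<close>
      have "i a = 0 \<or> i b = 0"
      proof (rule ccontr)
        assume "\<not> ?thesis"
        then have "i a = 1" "i b = 1" using le[of a] le[of b] \<open>a \<noteq> b\<close> by auto
        then have "i = j" using zero 2 by (auto simp: fun_eq_iff)
        with \<open>i \<noteq> j\<close> show False ..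
      qed
      then have "comp_val i g ?p = comp_val i g v \<or> comp_val i g ?p = comp_val i g u"
      proof
        assume "i a = 0"
        then have "comp_val i g ?p = comp_val i g v" by (intro comp_val_cong) auto
        then show ?thesis ..
      next
        assume "i b = 0"
        then have "comp_val i g ?p = comp_val i g u"
          using zero by (intro comp_val_cong) (metis fun_upd_apply)
        then show ?thesis ..
      qed
      then show ?thesis using I[OF g] by auto
    qed
    moreover have "?f \<in> vanishing_ideal X"
      by (rule in_I[OF f])
        (simp_all add: eval_diff eval_mult det2_add det2_swap[of "v a" "u a"] det2_swap[of "v b" "u b"])
    ultimately show ?thesis using f by blast
  qed
qed

section \<open>The lower bound on the number of generators\<close>

lemma comp_val_mult_ideal:
  assumes "\<And>i. i \<le> j \<Longrightarrow> i \<noteq> j \<Longrightarrow> comp_val i g p = 0"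
  shows "comp_val j (h * g) p = comp_val 0 h p * comp_val j g p"
proof -
  \<comment> \<open>Only the term \<open>i = j\<close> survives, so \<open>h\<close> enters through
    its constant term alone.\<close>
  have "comp_val j (h * g) p = (\<Sum>i | i \<le> j. if i = j then comp_val 0 h p * comp_val j g p else 0)"
    unfolding comp_val_mult using assms by (intro sum.cong) (auto simp: zero_fun_def)
  then show ?thesis by (simp add: finite_le_fun)
qed

text \<open>
  Otherwise there is a nontrivial combination of the separating forms whose coefficients with
  respect to \<open>G\<close> all have zero constant term, and every separating functional kills it.
\<close>

lemma card_generators_ge:
  fixes X :: "('k::finite \<Rightarrow> 'a::field_char_0 proj_line) set"
  assumes "generic_position X" "card X = 3" "finite G" "ideal_gen G = vanishing_ideal X"
  shows "card (generator_degrees :: ('k \<Rightarrow> nat) set) \<le> card G"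
proof (rule ccontr)
  assume "\<not> ?thesis"
  then have less: "card G < card (generator_degrees :: ('k \<Rightarrow> nat) set)" by simp
  interpret module "(*) :: ('k, 'a) mpoly \<Rightarrow> _" by (rule module_mult)
  let ?J = "generator_degrees :: ('k \<Rightarrow> nat) set" and ?I = "vanishing_ideal X"
  have G: "span G = ?I" using assms(4) by (simp add: ideal_gen_def)
  define sep where "sep j p f \<longleftrightarrow> f \<in> ?I \<and> f \<in> homog j \<and> eval_mpoly f p \<noteq> 0 \<and>
    (\<forall>g\<in>?I. \<forall>i. i \<le> j \<longrightarrow> i \<noteq> j \<longrightarrow> comp_val i g p = 0)" for j p f
  have "\<forall>j. \<exists>p f. j \<in> ?J \<longrightarrow> sep j p f"
    using ex_separating_functional[OF assms(1,2)] unfolding sep_def by blast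
  then obtain p f where "\<And>j. j \<in> ?J \<Longrightarrow> sep j (p j) (f j)" by metis
  then have
    f: "\<And>j. j \<in> ?J \<Longrightarrow> f j \<in> ?I" "\<And>j. j \<in> ?J \<Longrightarrow> f j \<in> homog j"
      "\<And>j. j \<in> ?J \<Longrightarrow> eval_mpoly (f j) (p j) \<noteq> 0"
    and p: "\<And>j g i. j \<in> ?J \<Longrightarrow> g \<in> ?I \<Longrightarrow> i \<le> j \<Longrightarrow> i \<noteq> j \<Longrightarrow> comp_val i g (p j) = 0"
    unfolding sep_def by blast+
  have "\<exists>h. f j = (\<Sum>g\<in>G. h g * g)" if "j \<in> ?J" for j
  proof -
    have "f j \<in> range (\<lambda>h. \<Sum>g\<in>G. h g * g)"
      using f(1)[OF that] unfolding G[symmetric] span_finite[OF assms(3)] .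
    then show ?thesis by (rule imageE) blast
  qed
  then obtain h where h: "\<And>j. j \<in> ?J \<Longrightarrow> f j = (\<Sum>g\<in>G. h j g * g)"
    using bchoice[of ?J "\<lambda>j h. f j = (\<Sum>g\<in>G. h g * g)"] by blast
  \<comment> \<open>The unknowns are indexed by degrees and the equations by generators. Constant
    terms are read off at the point 0, and \<open>k\<close> is a degree with nonzero coefficient,
    whose functional will give the contradiction.\<close>
  obtain c k where c: "k \<in> ?J" "c k \<noteq> 0"
    "\<And>g. g \<in> G \<Longrightarrow> (\<Sum>j\<in>?J. c j * comp_val 0 (h j g) 0) = 0"
    by (rule nontrivial_relation[OF assms(3) finite_generator_degrees less,
          of "\<lambda>j g. comp_val 0 (h j g) 0"]) blast
  have *: "comp_val k (f j) (p k) = (\<Sum>g\<in>G. comp_val 0 (h j g) 0 * comp_val k g (p k))"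
    if "j \<in> ?J" for j
  proof -
    have "comp_val k (f j) (p k) = (\<Sum>g\<in>G. comp_val k (h j g * g) (p k))"
      using h[OF that] by (simp add: comp_val_def lin_ext_sum)
    also have "\<dots> = (\<Sum>g\<in>G. comp_val 0 (h j g) (p k) * comp_val k g (p k))"
      using p[OF c(1)] span_base[of _ G] G by (intro sum.cong comp_val_mult_ideal) auto
    also have "\<dots> = (\<Sum>g\<in>G. comp_val 0 (h j g) 0 * comp_val k g (p k))"
      using comp_val_cong[of 0 "p k" 0] by simp
    finally show ?thesis .
  qed
  \<comment> \<open>Among the separating forms only \<open>f k\<close> has a component in degree
    \<open>k\<close>.\<close>
  have "c k * eval_mpoly (f k) (p k) = (\<Sum>j\<in>?J. if j = k then c k * eval_mpoly (f k) (p k) else 0)"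
    using c(1) by (simp add: finite_generator_degrees)
  also have "\<dots> = (\<Sum>j\<in>?J. c j * comp_val k (f j) (p k))"
    by (intro sum.cong refl) (simp add: comp_val_homog[OF f(2)])
  also have "\<dots> = (\<Sum>j\<in>?J. \<Sum>g\<in>G. c j * comp_val 0 (h j g) 0 * comp_val k g (p k))"
    by (intro sum.cong refl) (simp add: * sum_distrib_left mult_ac)
  also have "\<dots> = (\<Sum>g\<in>G. (\<Sum>j\<in>?J. c j * comp_val 0 (h j g) 0) * comp_val k g (p k))"
    unfolding sum_distrib_right by (rule sum.swap)
  also have "\<dots> = 0" using c(3) by simp
  finally show False using f(3)[OF c(1)] c(2) by simp
qed

theorem corollary5p7:
  fixes X :: "('k::finite \<Rightarrow> 'a::{alg_closed_field, field_char_0} proj_line) set"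
  assumes "CARD('k) \<ge> 3"
    and "card X = 3"
    and "generic_position X"
  shows "num_gens (vanishing_ideal X) \<ge> enat (nat (v_num TYPE('k) 3) + (CARD('k) choose 3))"
  unfolding num_gens_def
proof (rule Inf_greatest, clarify)
  fix G :: "('k, 'a) mpoly set"
  assume "finite G" "ideal_gen G = vanishing_ideal X"
  then have "card (generator_degrees :: ('k \<Rightarrow> nat) set) \<le> card G"
    using card_generators_ge assms by blast
  then show "enat (nat (v_num TYPE('k) 3) + (CARD('k) choose 3)) \<le> enat (card G)"
    using v_num_3_le[where 'k = 'k] unfolding card_generator_degrees by simp
qed

end
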